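(* $F_\infty(M(4)) = 9$, where $M(4)$ is the graph on $4$ vertices consisting of $2$ disjoint edges.
   Context: For a finite graph $G$ with $n$ vertices and an integer $b\ge 0$, a permutation of the vertices of $G$ with $b$ blank spaces is a sequence of length $n+b$ in which every vertex of $G$ appears exactly once and the remaining $b$ entries are a blank symbol $*$. Two such sequences $\pi,\sigma$ are $G$-different if there is a position $i$ such that $\pi(i),\sigma(i)$ are both vertices and $\{\pi(i),\sigma(i)\}$ is an edge of $G$. $F_b(G)$ is the maximum size of a family of pairwise $G$-different permutations of the vertices of $G$ with $b$ blank spaces, and $F_\infty(G)=\sup_{b\ge0}F_b(G)$. *)

theory Defs
  imports "HOL-Library.Extended_Nat"
begin

definition finite_graph :: "'a set \<Rightarrow> 'a set set \<Rightarrow> bool" where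
  "finite_graph V E \<longleftrightarrow> finite V \<and> (\<forall>e\<in>E. e \<subseteq> V \<and> card e = 2)"

text \<open>The blank symbol is \<^term>\<open>None\<close>; a vertex \<open>v\<close> occurs in a sequence as \<^term>\<open>Some v\<close>.\<close>

definition blank_perms :: "'a set \<Rightarrow> nat \<Rightarrow> 'a option list set" where
  "blank_perms V b =
     {p. length p = card V + b \<and> set p \<subseteq> insert None (Some ` V) \<and>
         (\<forall>v\<in>V. count_list p (Some v) = 1)}"

definition G_different :: "'a set set \<Rightarrow> 'a option list \<Rightarrow> 'a option list \<Rightarrow> bool" where
  "G_different E p q \<longleftrightarrow>
     (\<exists>i u v. i < length p \<and> i < length q \<and> p ! i = Some u \<and> q ! i = Some v \<and> {u, v} \<in> E)"

definition different_families :: "'a set \<Rightarrow> 'a set set \<Rightarrow> nat \<Rightarrow> 'a option list set set" where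
  "different_families V E b = {A. A \<subseteq> blank_perms V b \<and> pairwise (G_different E) A}"

definition F :: "nat \<Rightarrow> 'a set \<Rightarrow> 'a set set \<Rightarrow> nat" where
  "F b V E = Max (card ` different_families V E b)"

lemma finite_blank_perms:
  assumes "finite V"
  shows "finite (blank_perms V b)"
proof (rule finite_subset)
  show "blank_perms V b \<subseteq> {p. set p \<subseteq> insert None (Some ` V) \<and> length p = card V + b}"
    by (auto simp: blank_perms_def)
  show "finite {p. set p \<subseteq> insert None (Some ` V) \<and> length p = card V + b}"
    using assms by (intro finite_lists_length_eq) simp
qed

text \<open>For a finite vertex set the maximum in \<open>F\<close> ranges over a finite nonempty set.\<close>

lemma finite_different_families:
  assumes "finite V"
  shows "finite (different_families V E b)"
  using finite_blank_perms[OF assms, of b] by (simp add: different_families_def)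

lemma empty_in_different_families: "{} \<in> different_families V E b"
  by (simp add: different_families_def)

text \<open>The supremum is taken in \<^typ>\<open>enat\<close>, where it is the true supremum even of an unbounded set.\<close>

definition F_infinity :: "'a set \<Rightarrow> 'a set set \<Rightarrow> enat" where
  "F_infinity V E = (SUP b. enat (F b V E))"

text \<open>\<open>M n\<close> is determined up to isomorphism: \<open>n\<close> vertices and \<open>n / 2\<close> pairwise disjoint edges.\<close>

definition is_M :: "nat \<Rightarrow> 'a set \<Rightarrow> 'a set set \<Rightarrow> bool" where
  "is_M n V E \<longleftrightarrow> finite_graph V E \<and> card V = n \<and> 2 * card E = n \<and> pairwise disjnt E"

lemma is_M_4_example: "is_M 4 {0, 1, 2, 3 :: nat} {{0, 1}, {2, 3}}"
proof -
  have "{0, 1} \<noteq> {2, 3 :: nat}" by (simp add: doubleton_eq_iff)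
  then have "card {{0, 1}, {2, 3 :: nat}} = 2" by (rule card_2_iff[THEN iffD2, OF exI, OF exI, OF conjI, OF refl])
  then show ?thesis
    by (simp add: is_M_def finite_graph_def pairwise_insert disjnt_def)
qed

end

theory Submission
  imports Defs
begin

text \<open>
  Let the edges be \<open>{a, a'}\<close> and \<open>{c, c'}\<close>. A sequence is then a pair of arcs between positions, one
  from the place of \<open>a\<close> to that of \<open>a'\<close>, one from the place of \<open>c\<close> to that of \<open>c'\<close>; two sequences
  are different iff, for one of the two colours, the head of one arc is the tail of the other.
  Letting the two arcs run independently through two directed triangles gives 9 sequences.

  Suppose there are 10. Arcs of one colour that pairwise follow each other number at most 3, so in
  each colour a set of arcs in which no head is a tail has at most 3 members. Identifying
  positions not joined by an arc, one may assume that any two positions are joined; as 10 arcs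
  cannot join all pairs of 6 positions, at most 5 remain. Averaging the directed cuts \<open>{u, v}\<close> over
  \<open>v\<close> then yields \<open>2 out(u) - in(u) \<le> 2\<close>, and likewise with in and out exchanged, so all
  in- and out-degrees are at most 2. Hence each sequence differs from at most
  \<open>2 + 2 + 2 + 2 < 9\<close> others.
\<close>

section \<open>Bounding families of arc pairs\<close>

text \<open>No arc is followed by two others: if \<open>y i = x j\<close> and
  \<open>y i = x k\<close>, then \<open>j\<close> and \<open>k\<close> share a tail, so whichever
  follows the other makes a loop. Hence n arcs form at most n consecutive pairs, and n (n - 1) / 2
  \<le> n forces n \<le> 3.\<close>

lemma card_consecutive_arcs_le_3:
  assumes "finite S"
    and loopless: "\<And>i. i \<in> S \<Longrightarrow> x i \<noteq> y i"
    and consecutive: "\<And>i j. i \<in> S \<Longrightarrow> j \<in> S \<Longrightarrow> i \<noteq> j \<Longrightarrow> y i = x j \<or> y j = x i"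
  shows "card S \<le> 3"
proof (rule ccontr)
  assume "\<not> card S \<le> 3"
  then obtain T where "T \<subseteq> S" "card T = 4"
    using obtain_subset_with_card_n[of 4 S] by auto
  then obtain ts where "set ts \<subseteq> S" "distinct ts" "length ts = 4"
    using finite_distinct_list[of T] \<open>finite S\<close> by (metis distinct_card finite_subset)
  then obtain p q r s where "p \<in> S" "q \<in> S" "r \<in> S" "s \<in> S"
    and "p \<noteq> q" "p \<noteq> r" "p \<noteq> s" "q \<noteq> r" "q \<noteq> s" "r \<noteq> s"
    by (auto simp: length_Suc_conv numeral_eq_Suc)
  then have "y p = x q \<or> y q = x p" "y p = x r \<or> y r = x p" "y p = x s \<or> y s = x p"
    "y q = x r \<or> y r = x q" "y q = x s \<or> y s = x q" "y r = x s \<or> y s = x r"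
    "x p \<noteq> y p" "x q \<noteq> y q" "x r \<noteq> y r" "x s \<noteq> y s"
    using consecutive loopless by blast+
  then show False by metis
qed

text \<open>Among the maps that collapse no arc, \<open>g\<close> is chosen with smallest image. Any
  two points of the image are then joined by an arc, so there are at most as many pairs of points as
  arcs.\<close>

lemma identify_nonadjacent:
  fixes x y :: "'i \<Rightarrow> 'p"
  assumes "finite I" and loopless: "\<And>i. i \<in> I \<Longrightarrow> x i \<noteq> y i"
  obtains g :: "'p \<Rightarrow> 'p"
  where "\<And>i. i \<in> I \<Longrightarrow> g (x i) \<noteq> g (y i)"
    and "card (g ` (x ` I \<union> y ` I)) choose 2 \<le> card I"
proof -
  define P where "P = x ` I \<union> y ` I"
  define ok where "ok = (\<lambda>g :: 'p \<Rightarrow> 'p. \<forall>i\<in>I. g (x i) \<noteq> g (y i))"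
  have "finite P" using \<open>finite I\<close> by (simp add: P_def)
  have "ok id" using loopless by (simp add: ok_def)
  then obtain g where g: "ok g" and min: "\<And>h. ok h \<Longrightarrow> card (g ` P) \<le> card (h ` P)"
    using exists_least_iff[of "\<lambda>n. \<exists>g. ok g \<and> card (g ` P) = n"] by (metis not_le)
  have joined: "\<exists>i\<in>I. {g (x i), g (y i)} = {u, v}"
    if "u \<in> g ` P" "v \<in> g ` P" "u \<noteq> v" for u v
  proof (rule ccontr)
    assume not_joined: "\<not> ?thesis"
    \<comment> \<open>\<open>h\<close> merges \<open>v\<close> into \<open>u\<close>. No arc runs
      between the two, so none collapses, yet the image loses \<open>v\<close>, against
      minimality.\<close>
    define h where "h p = (if g p = v then u else g p)" for p
    have "ok h"
      using g not_joined by (auto simp: ok_def h_def doubleton_eq_iff)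
    moreover have "h ` P \<subseteq> g ` P - {v}"
      using that by (auto simp: h_def)
    then have "card (h ` P) \<le> card (g ` P - {v})"
      using \<open>finite P\<close> by (intro card_mono) auto
    then have "card (h ` P) < card (g ` P)"
      using card_Diff1_less[of "g ` P" v] that \<open>finite P\<close> by simp
    ultimately show False using min by (metis not_le)
  qed
  have "{B. B \<subseteq> g ` P \<and> card B = 2} \<subseteq> (\<lambda>i. {g (x i), g (y i)}) ` I"
  proof
    fix B assume "B \<in> {B. B \<subseteq> g ` P \<and> card B = 2}"
    then obtain u v where "B = {u, v}" "u \<noteq> v" "u \<in> g ` P" "v \<in> g ` P"
      by (auto simp: card_2_iff)
    with joined[of u v] show "B \<in> (\<lambda>i. {g (x i), g (y i)}) ` I" by blast
  qed
  then have "card {B. B \<subseteq> g ` P \<and> card B = 2} \<le> card I"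
    using \<open>finite I\<close> by (meson card_image_le card_mono finite_imageI le_trans)
  then have "card (g ` P) choose 2 \<le> card I"
    using \<open>finite P\<close> by (simp add: n_subsets)
  with g show thesis by (intro that) (auto simp: ok_def P_def)
qed

text \<open>Double count the pairs of a point \<open>v \<noteq> u\<close> and an arc leaving
  \<open>{u, v}\<close>. The four cuts have at most 3 arcs each, 12 in all; counted by arcs, the
  number is 10 + 2 out(u) - in(u).\<close>

lemma degree_bound_of_small_cuts:
  assumes "finite I" "card I = 10" "finite K" "card K = 5"
    and x: "\<And>i. i \<in> I \<Longrightarrow> x i \<in> K" and y: "\<And>i. i \<in> I \<Longrightarrow> y i \<in> K"
    and loopless: "\<And>i. i \<in> I \<Longrightarrow> x i \<noteq> y i"
    and cuts: "\<And>S. S \<subseteq> I \<Longrightarrow> (\<And>i j. i \<in> S \<Longrightarrow> j \<in> S \<Longrightarrow> y i \<noteq> x j) \<Longrightarrow> card S \<le> 3"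
    and "u \<in> K"
  shows "2 * card {i \<in> I. x i = u} \<le> card {i \<in> I. y i = u} + 2"
proof -
  define T where "T v = {i \<in> I. x i \<in> {u, v} \<and> y i \<notin> {u, v}}" for v
  have card_filter: "card {i \<in> I. Q i} = (\<Sum>i\<in>I. of_bool (Q i))" for Q :: "_ \<Rightarrow> bool"
    using \<open>finite I\<close> by (simp add: of_bool_def Collect_conj_eq flip: sum.inter_filter)
  \<comment> \<open>An arc out of \<open>u\<close> leaves \<open>{u, v}\<close> for the three
    \<open>v\<close> other than \<open>u\<close> and its head, an arc into \<open>u\<close> for
    none, any other arc only when \<open>v\<close> is its tail. The summand for arcs into
    \<open>u\<close> stands on the left to avoid subtraction on \<open>nat\<close>.\<close>
  have pointwise: "(\<Sum>v\<in>K - {u}. of_bool (x i \<in> {u, v} \<and> y i \<notin> {u, v})) + of_bool (y i = u)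
      = 1 + 2 * (of_bool (x i = u) :: nat)" if "i \<in> I" for i
  proof -
    have "(\<Sum>v\<in>K - {u}. of_bool (x i \<in> {u, v} \<and> y i \<notin> {u, v}))
        = card {v \<in> K - {u}. x i \<in> {u, v} \<and> y i \<notin> {u, v}}"
      using \<open>finite K\<close> by (simp add: of_bool_def Collect_conj_eq flip: sum.inter_filter)
    also have "{v \<in> K - {u}. x i \<in> {u, v} \<and> y i \<notin> {u, v}}
        = (if x i = u then K - {u, y i} else if y i = u then {} else {x i})"
      using x[OF that] y[OF that] loopless[OF that] by auto
    finally show ?thesis
      using \<open>u \<in> K\<close> y[OF that] loopless[OF that] \<open>finite K\<close> \<open>card K = 5\<close>
      by (auto simp: card_Diff_subset)
  qed
  have "(\<Sum>v\<in>K - {u}. card (T v)) = (\<Sum>i\<in>I. \<Sum>v\<in>K - {u}. of_bool (x i \<in> {u, v} \<and> y i \<notin> {u, v}))"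
    unfolding T_def card_filter by (rule sum.swap)
  then have "(\<Sum>v\<in>K - {u}. card (T v)) + card {i \<in> I. y i = u} = (\<Sum>i\<in>I. 1 + 2 * of_bool (x i = u))"
    unfolding card_filter using pointwise by (simp flip: sum.distrib cong: sum.cong)
  also have "\<dots> = 10 + 2 * card {i \<in> I. x i = u}"
    unfolding card_filter sum.distrib sum_distrib_left using \<open>card I = 10\<close> by simp
  finally have "(\<Sum>v\<in>K - {u}. card (T v)) + card {i \<in> I. y i = u} = 10 + 2 * card {i \<in> I. x i = u}" .
  moreover have "card (T v) \<le> 3" for v
    by (intro cuts) (auto simp: T_def)
  then have "(\<Sum>v\<in>K - {u}. card (T v)) \<le> card (K - {u}) * 3"
    using sum_bounded_above[of "K - {u}" "\<lambda>v. card (T v)" 3] by simp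
  ultimately show ?thesis
    using \<open>u \<in> K\<close> \<open>finite K\<close> \<open>card K = 5\<close> by simp
qed

lemma degrees_le_2:
  fixes x y :: "'i \<Rightarrow> 'p"
  assumes "finite I" "card I = 10"
    and loopless: "\<And>i. i \<in> I \<Longrightarrow> x i \<noteq> y i"
    and cuts: "\<And>S. S \<subseteq> I \<Longrightarrow> (\<And>i j. i \<in> S \<Longrightarrow> j \<in> S \<Longrightarrow> y i \<noteq> x j) \<Longrightarrow> card S \<le> 3"
  shows "card {i \<in> I. x i = p} \<le> 2" and "card {i \<in> I. y i = p} \<le> 2"
proof -
  define P where "P = x ` I \<union> y ` I"
  obtain g :: "'p \<Rightarrow> 'p" where g: "\<And>i. i \<in> I \<Longrightarrow> g (x i) \<noteq> g (y i)"
    and "card (g ` P) choose 2 \<le> card I"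
    using identify_nonadjacent[of I x y] \<open>finite I\<close> loopless unfolding P_def by blast
  \<comment> \<open>Six points would have 15 pairs, more than the 10 arcs can join.\<close>
  have "15 \<le> n choose 2" if "6 \<le> n" for n :: nat
    using div_le_mono[OF mult_le_mono[OF that diff_le_mono[OF that, of 1]], of 2]
    by (simp add: choose_two)
  from this[of "card (g ` P)"] have "card (g ` P) \<le> card {..<5 :: nat}"
    using \<open>card (g ` P) choose 2 \<le> card I\<close> \<open>card I = 10\<close>
    by (cases "6 \<le> card (g ` P)") auto
  moreover have "finite P" using \<open>finite I\<close> by (simp add: P_def)
  \<comment> \<open>The degree bound wants exactly 5 points; if fewer classes remain, the embedding
    leaves points that meet no arc.\<close>
  ultimately obtain e where e: "e ` g ` P \<subseteq> {..<5 :: nat}" "inj_on e (g ` P)"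
    using card_le_inj[of "g ` P" "{..<5 :: nat}"] by auto
  define X Y where "X i = e (g (x i))" and "Y i = e (g (y i))" for i
  have range: "X i \<in> {..<5}" "Y i \<in> {..<5}" if "i \<in> I" for i
    using that unfolding X_def Y_def P_def by (intro subsetD[OF e(1)[unfolded P_def]] imageI; simp)+
  have ne: "X i \<noteq> Y i" if "i \<in> I" for i
    using g[OF that] e(2) that by (auto simp: X_def Y_def P_def inj_on_def)
  \<comment> \<open>Equal positions have equal images, so a cut of the quotient is already a cut of
    the original arcs.\<close>
  have cuts': "card S \<le> 3" if "S \<subseteq> I" "\<And>i j. i \<in> S \<Longrightarrow> j \<in> S \<Longrightarrow> Y i \<noteq> X j" for S
    using that unfolding X_def Y_def by (metis cuts)
  have deg: "card {i \<in> I. X i = u} \<le> 2 \<and> card {i \<in> I. Y i = u} \<le> 2" if "u \<in> {..<5}" for u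
  proof -
    note bound = degree_bound_of_small_cuts[OF \<open>finite I\<close> \<open>card I = 10\<close>, of "{..<5}" _ _ u]
    have "2 * card {i \<in> I. X i = u} \<le> card {i \<in> I. Y i = u} + 2"
      by (rule bound) (use range ne cuts' that in simp_all)
    \<comment> \<open>Reversing all arcs preserves the cut condition, so the bound also holds with
      in and out exchanged.\<close>
    moreover have "card S \<le> 3" if "S \<subseteq> I" "\<And>i j. i \<in> S \<Longrightarrow> j \<in> S \<Longrightarrow> X i \<noteq> Y j" for S
      using that cuts'[of S] by metis
    then have "2 * card {i \<in> I. Y i = u} \<le> card {i \<in> I. X i = u} + 2"
      by (intro bound) (use range ne[symmetric] that in simp_all)
    \<comment> \<open>From 2 out \<le> in + 2 and 2 in \<le> out + 2 follows 3 out \<le> 6, and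
      symmetrically for in.\<close>
    ultimately show ?thesis by linarith
  qed
  have "card {i \<in> I. x i = p} \<le> 2 \<and> card {i \<in> I. y i = p} \<le> 2"
  proof (cases "p \<in> P")
    case True
    then have "e (g p) \<in> {..<5}" using e(1) by blast
    \<comment> \<open>Identifying positions can only raise degrees.\<close>
    moreover have "card {i \<in> I. x i = p} \<le> card {i \<in> I. X i = e (g p)}"
      "card {i \<in> I. y i = p} \<le> card {i \<in> I. Y i = e (g p)}"
      using \<open>finite I\<close> by (auto intro!: card_mono simp: X_def Y_def)
    ultimately show ?thesis using deg by (meson le_trans)
  next
    case False
    then have "{i \<in> I. x i = p} = {}" "{i \<in> I. y i = p} = {}"
      by (auto simp: P_def)
    then show ?thesis by (simp only: card.empty) simp
  qed
  then show "card {i \<in> I. x i = p} \<le> 2" "card {i \<in> I. y i = p} \<le> 2"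
    by simp_all
qed

lemma card_arc_pairs_le_9:
  fixes x y :: "'i \<Rightarrow> 'p" and z w :: "'i \<Rightarrow> 'q"
  assumes "finite I"
    and xy: "\<And>i. i \<in> I \<Longrightarrow> x i \<noteq> y i" and zw: "\<And>i. i \<in> I \<Longrightarrow> z i \<noteq> w i"
    and related: "\<And>i j. i \<in> I \<Longrightarrow> j \<in> I \<Longrightarrow> i \<noteq> j \<Longrightarrow>
      y i = x j \<or> y j = x i \<or> w i = z j \<or> w j = z i"
  shows "card I \<le> 9"
proof (rule ccontr)
  assume "\<not> card I \<le> 9"
  then obtain J where J: "J \<subseteq> I" "card J = 10"
    using obtain_subset_with_card_n[of 10 I] by auto
  with \<open>finite I\<close> have "finite J" by (auto intro: finite_subset)
  \<comment> \<open>Inside such a set the first colour relates no pair, so the arcs of the second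
    colour are pairwise consecutive.\<close>
  have cuts_xy: "card S \<le> 3" if "S \<subseteq> J" "\<And>i j. i \<in> S \<Longrightarrow> j \<in> S \<Longrightarrow> y i \<noteq> x j" for S
  proof (rule card_consecutive_arcs_le_3[of S z w])
    show "w i = z j \<or> w j = z i" if "i \<in> S" "j \<in> S" "i \<noteq> j" for i j
      using that related[of i j] \<open>S \<subseteq> J\<close> \<open>J \<subseteq> I\<close> \<open>\<And>i j. i \<in> S \<Longrightarrow> j \<in> S \<Longrightarrow> y i \<noteq> x j\<close>
      by blast
  qed (use that zw J \<open>finite J\<close> in \<open>auto intro: finite_subset\<close>)
  have cuts_zw: "card S \<le> 3" if "S \<subseteq> J" "\<And>i j. i \<in> S \<Longrightarrow> j \<in> S \<Longrightarrow> w i \<noteq> z j" for S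
  proof (rule card_consecutive_arcs_le_3[of S x y])
    show "y i = x j \<or> y j = x i" if "i \<in> S" "j \<in> S" "i \<noteq> j" for i j
      using that related[of i j] \<open>S \<subseteq> J\<close> \<open>J \<subseteq> I\<close> \<open>\<And>i j. i \<in> S \<Longrightarrow> j \<in> S \<Longrightarrow> w i \<noteq> z j\<close>
      by blast
  qed (use that xy J \<open>finite J\<close> in \<open>auto intro: finite_subset\<close>)
  have xy': "x i \<noteq> y i" and zw': "z i \<noteq> w i" if "i \<in> J" for i
    using that J xy zw by auto
  note deg_xy = degrees_le_2[OF \<open>finite J\<close> \<open>card J = 10\<close> xy' cuts_xy]
  note deg_zw = degrees_le_2[OF \<open>finite J\<close> \<open>card J = 10\<close> zw' cuts_zw]
  obtain i where "i \<in> J" using \<open>card J = 10\<close> by fastforce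
  let ?A = "{j \<in> J. x j = y i}" and ?B = "{j \<in> J. y j = x i}"
  let ?C = "{j \<in> J. z j = w i}" and ?D = "{j \<in> J. w j = z i}"
  \<comment> \<open>Nine other indices would have to fit into four sets of at most two members
    each.\<close>
  have "J - {i} \<subseteq> (?A \<union> ?B) \<union> (?C \<union> ?D)"
  proof
    fix j assume "j \<in> J - {i}"
    then show "j \<in> (?A \<union> ?B) \<union> (?C \<union> ?D)"
      using related[of i j] J \<open>i \<in> J\<close> by (simp add: subset_iff) metis
  qed
  then have "card (J - {i}) \<le> card ((?A \<union> ?B) \<union> (?C \<union> ?D))"
    using \<open>finite J\<close> by (intro card_mono) auto
  also have "\<dots> \<le> (card ?A + card ?B) + (card ?C + card ?D)"
    by (intro order_trans[OF card_Un_le] add_mono card_Un_le)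
  also have "\<dots> \<le> (2 + 2) + (2 + 2)"
    by (intro add_mono deg_xy deg_zw)
  finally show False
    using \<open>i \<in> J\<close> \<open>card J = 10\<close> \<open>finite J\<close> by simp
qed

section \<open>From sequences to arcs\<close>

lemma is_M_4E:
  assumes "is_M 4 V E"
  obtains a a' c c' where "V = {a, a', c, c'}" "E = {{a, a'}, {c, c'}}" "distinct [a, a', c, c']"
proof -
  have E: "finite V" "card V = 4" "card E = 2" "\<And>e. e \<in> E \<Longrightarrow> e \<subseteq> V \<and> card e = 2"
    "pairwise disjnt E"
    using assms by (auto simp: is_M_def finite_graph_def)
  obtain e f where ef: "E = {e, f}" "e \<noteq> f" using E(3) by (auto simp: card_2_iff)
  then have "card e = 2" "card f = 2" "disjnt e f" using E by (auto simp: pairwise_insert)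
  then obtain a a' c c' where *: "e = {a, a'}" "f = {c, c'}" "distinct [a, a', c, c']"
    by (auto simp: card_2_iff disjnt_def)
  moreover have "{a, a', c, c'} = V"
    using * E ef by (intro card_subset_eq) auto
  ultimately show thesis using that ef by blast
qed

lemma blank_perm_position:
  assumes "p \<in> blank_perms V b" "v \<in> V"
  shows "\<exists>!i. i < length p \<and> p ! i = Some v"
proof -
  have "count_list p (Some v) = 1" using assms by (simp add: blank_perms_def)
  then have "card {i. i < length p \<and> p ! i = Some v} = 1"
    by (simp add: count_list_eq_length_filter length_filter_conv_card eq_commute)
  then obtain i where "{i. i < length p \<and> p ! i = Some v} = {i}"
    by (auto simp: card_1_singleton_iff)
  then have "j < length p \<and> p ! j = Some v \<longleftrightarrow> j = i" for j
    by (simp add: set_eq_iff)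
  then show ?thesis by simp
qed

lemma card_different_family_le_9:
  assumes "is_M 4 V E" "A \<in> different_families V E b"
  shows "card A \<le> 9"
proof -
  obtain a a' c c' where V: "V = {a, a', c, c'}" and E: "E = {{a, a'}, {c, c'}}"
    and "distinct [a, a', c, c']"
    using is_M_4E[OF assms(1)] by metis
  have A: "A \<subseteq> blank_perms V b" "pairwise (G_different E) A"
    using assms(2) by (auto simp: different_families_def)
  \<comment> \<open>The family itself indexes the arcs. The description denotes a unique position
    only for members of \<open>A\<close> and vertices in \<open>V\<close>.\<close>
  define pos where "pos v p = (THE i. i < length p \<and> p ! i = Some v)" for v :: 'a and p
  have pos: "pos v p < length p \<and> p ! pos v p = Some v" if "p \<in> A" "v \<in> V" for p v
    unfolding pos_def using that A by (intro theI'[OF blank_perm_position]) auto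
  have pos_eq: "pos v p = i" if "p \<in> A" "v \<in> V" "i < length p" "p ! i = Some v" for p v i
    using blank_perm_position[of p V b v] pos[OF that(1,2)] that A by (metis subsetD)
  show ?thesis
  proof (rule card_arc_pairs_le_9[of A "pos a" "pos a'" "pos c" "pos c'"])
    have "finite V" by (simp add: V)
    then show "finite A" using A finite_blank_perms finite_subset by metis
    show "pos a p \<noteq> pos a' p" "pos c p \<noteq> pos c' p" if "p \<in> A" for p
      using pos[OF that, of a] pos[OF that, of a'] pos[OF that, of c] pos[OF that, of c']
        \<open>distinct [a, a', c, c']\<close> by (auto simp: V)
    show "pos a' p = pos a q \<or> pos a' q = pos a p \<or> pos c' p = pos c q \<or> pos c' q = pos c p"
      if "p \<in> A" "q \<in> A" "p \<noteq> q" for p q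
    proof -
      have "G_different E p q" using A that by (auto simp: pairwise_def)
      then obtain i u v where i: "i < length p" "i < length q" "p ! i = Some u" "q ! i = Some v"
        and uv: "{u, v} \<in> E"
        by (auto simp: G_different_def)
      from uv have "u \<in> V" "v \<in> V" by (auto simp: E V doubleton_eq_iff)
      then have "pos u p = i" "pos v q = i" using i that pos_eq by auto
      with uv show ?thesis by (auto simp: E doubleton_eq_iff)
    qed
  qed
qed

section \<open>A family of nine sequences\<close>

text \<open>As arcs from the place of \<open>u\<close> to that of \<open>v\<close>, these are the
  three arcs of the directed triangle 0, 1, 2; any two of them are consecutive.\<close>

definition blank_rotations :: "'a \<Rightarrow> 'a \<Rightarrow> 'a option list set" where
  "blank_rotations u v =
     {[Some u, Some v, None], [None, Some u, Some v], [Some v, None, Some u]}"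

lemma G_different_blank_rotations:
  assumes "p \<in> blank_rotations u v" "q \<in> blank_rotations u v" "p \<noteq> q" "{u, v} \<in> E"
  shows "G_different E p q"
proof -
  have "{v, u} \<in> E" using assms(4) by (simp add: insert_commute)
  have "\<exists>i\<in>{0, 1, 2}. (p ! i, q ! i) \<in> {(Some u, Some v), (Some v, Some u)}"
    using assms(1-3) unfolding blank_rotations_def by (elim insertE emptyE) simp_all
  moreover have "\<forall>i\<in>{0, 1, 2}. i < (3 :: nat)" by simp
  ultimately obtain i where "i < 3" "(p ! i, q ! i) \<in> {(Some u, Some v), (Some v, Some u)}"
    by blast
  moreover have "length p = 3" "length q = 3"
    using assms(1,2) by (auto simp: blank_rotations_def)
  ultimately show ?thesis
    using assms(4) \<open>{v, u} \<in> E\<close> unfolding G_different_def by auto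
qed

lemma G_different_append:
  assumes "length p = length p'"
    and "G_different E p p' \<or> G_different E q q'"
  shows "G_different E (p @ q) (p' @ q')"
  using assms(2)
proof
  assume "G_different E p p'"
  then obtain i u v where "i < length p" "i < length p'" "p ! i = Some u" "p' ! i = Some v" "{u, v} \<in> E"
    by (auto simp: G_different_def)
  then show ?thesis
    unfolding G_different_def by (intro exI[of _ i] exI[of _ u] exI[of _ v]) (simp add: nth_append)
next
  assume "G_different E q q'"
  then obtain i u v where "i < length q" "i < length q'" "q ! i = Some u" "q' ! i = Some v" "{u, v} \<in> E"
    by (auto simp: G_different_def)
  then show ?thesis
    unfolding G_different_def using assms(1)
    by (intro exI[of _ "length p + i"] exI[of _ u] exI[of _ v]) (simp add: nth_append)
qed

text \<open>Two blocks of length 3 with one blank each give length 6, hence 2 blanks. Distinct pairs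
  of blocks differ in some block, and that block supplies the edge.\<close>

lemma ex_different_family_9:
  assumes "is_M 4 V E"
  shows "\<exists>A \<in> different_families V E 2. card A = 9"
proof -
  obtain a a' c c' where V: "V = {a, a', c, c'}" and E: "E = {{a, a'}, {c, c'}}"
    and d: "distinct [a, a', c, c']"
    using is_M_4E[OF assms] by metis
  define R where "R = blank_rotations a a' \<times> blank_rotations c c'"
  have len: "length p = 3" if "(p, q) \<in> R" for p q
    using that by (auto simp: R_def blank_rotations_def)
  \<comment> \<open>As all first blocks have length 3, a concatenation determines both of its
    blocks.\<close>
  have inj: "inj_on (\<lambda>(p, q). p @ q) R"
    using len by (auto simp: inj_on_def dest: len)
  have "card R = 9"
    using d by (simp add: R_def card_cartesian_product blank_rotations_def)
  then have "card ((\<lambda>(p, q). p @ q) ` R) = 9"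
    using inj by (simp add: card_image)
  moreover have "(\<lambda>(p, q). p @ q) ` R \<subseteq> blank_perms V 2"
    using d by (auto simp: R_def blank_rotations_def blank_perms_def V)
  moreover have "pairwise (G_different E) ((\<lambda>(p, q). p @ q) ` R)"
  proof (rule pairwiseI, clarify)
    fix p q p' q' assume pq: "(p, q) \<in> R" "(p', q') \<in> R" "p @ q \<noteq> p' @ q'"
    then have "G_different E p p' \<or> G_different E q q'"
      using G_different_blank_rotations[of p a a' p' E] G_different_blank_rotations[of q c c' q' E]
      by (auto simp: R_def E)
    then show "G_different E (p @ q) (p' @ q')"
      using pq len by (intro G_different_append) simp_all
  qed
  ultimately show ?thesis by (auto simp: different_families_def)
qed

theorem theorem5:
  fixes V :: "'a set" and E :: "'a set set"
  assumes "is_M 4 V E"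
  shows "F_infinity V E = 9"
proof -
  have "finite V" using assms by (simp add: is_M_def finite_graph_def)
  note fin = finite_different_families[OF this]
  have "F b V E \<le> 9" for b
    unfolding F_def using card_different_family_le_9[OF assms] fin
      empty_in_different_families[of V E b]
    by (subst Max_le_iff) auto
  then have "F_infinity V E \<le> 9"
    unfolding F_infinity_def by (intro SUP_least) (simp add: numeral_eq_enat)
  moreover have "9 \<le> F 2 V E"
    unfolding F_def using ex_different_family_9[OF assms] fin
    by (metis Max_ge finite_imageI imageI)
  then have "9 \<le> F_infinity V E"
    unfolding F_infinity_def by (intro SUP_upper2[of 2]) (simp_all add: numeral_eq_enat)
  ultimately show ?thesis by (rule antisym)
qed

end
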